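(* Let $Q\subset\mathbb{R}^{d+1}$ be an open set, $\mathfrak K\subset W^{2,d+1}_{\mathrm{loc}}(Q)$ a convex cone, and $\Sigma\subseteq\partial_PQ$ an open subset. Let $Lu=-u_t-\operatorname{tr}(aD^2u)-\langle b,Du\rangle+cu$, and assume that for every open subset $U\subset Q$, $L$ has the weak maximum principle property on $U\cup\Sigma$ for $\mathfrak K$. Let $f,\psi\in L^{d+1}_{\mathrm{loc}}(Q)$. Suppose $u\in\mathfrak K$ is a solution and $v\in-\mathfrak K$ is a supersolution to the obstacle problem, that is, $$\min\{Lu-f,\ u-\psi\}=0\quad\text{and}\quad\min\{Lv-f,\ v-\psi\}\ge0\qquad\text{a.e. on }Q.$$ (a) If $v_*\ge u^*$ on $\partial_PQ\setminus\overline\Sigma$, then $v\ge u$ on $Q$. (b) If $u,v$ are (both) solutions and $v_*=u^*$ on $\partial_PQ\setminus\overline\Sigma$, then $u=v$ on $Q$.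
   Context: Points of $\mathbb{R}^{d+1}$ are $(t,x)$, $t\in\mathbb{R}$, $x\in\mathbb{R}^d$; $D,D^2$ are the gradient and Hessian in $x$ only. The coefficients $a$ (values in non-negative definite symmetric $d\times d$ matrices), $b$ ($\mathbb{R}^d$-valued), $c$ (real-valued) are measurable and defined a.e. on $Q$. For an open set $U\subset\mathbb{R}^{d+1}$ with topological boundary $\partial U$, the parabolic boundary (terminal-value convention) is $\partial_PU:=\{(t^0,x^0)\in\partial U:\ \{(t,x):|x-x^0|<\varepsilon,\ t^0-\varepsilon^2<t<t^0\}\cap U\neq\emptyset\ \ \forall\,\varepsilon>0\}$. $\overline\Sigma$ is the closure of $\Sigma$ in $\partial Q$. $W^{2,p}_{\mathrm{loc}}(Q)$ is the set of measurable $u$ such that $u$ and its weak derivatives $u_t,u_{x_i},u_{x_ix_j}$ belong to $L^p_{\mathrm{loc}}(Q)$; elements of $W^{2,d+1}_{\mathrm{loc}}(Q)$ are identified with their continuous representatives. $u^*,u_*:\overline Q\to[-\infty,\infty]$ are the upper and lower semicontinuous envelopes (limsup and liminf from $Q$). A convex cone $\mathfrak K$ satisfies $\alpha u+\beta v\in\mathfrak K$ whenever $u,v\in\mathfrak K$ and $\alpha,\beta\ge0$. Weak maximum principle property on $U\cup\Sigma$ for $\mathfrak K$, where $U\subset Q$ is open: whenever $w\in\mathfrak K$ satisfies $Lw\le0$ a.e. on $U$ and $(w|_U)^*\le0$ on $\partial_PU\setminus\overline\Sigma$ (envelope taken from $U$), then $w\le0$ on $U$.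
   Formalization: The claim is false as written, so in (a), wherever v_* = u^* on the boundary portion, the common value must be finite; in (b) it is also assumed that v ∈ K and u ∈ −K, that u_* = v^* as well as v_* = u^*, and that these boundary values are finite. *)

theory Defs
  imports "HOL-Analysis.Analysis"
begin

type_synonym 'd pt = "real \<times> (real ^ 'd)"  \<comment> \<open>points \<open>(t, x)\<close>\<close>

definition parabolic_boundary :: "('d::finite) pt set \<Rightarrow> 'd pt set" where
  "parabolic_boundary U =
     {(t0, x0). (t0, x0) \<in> frontier U \<and>
        (\<forall>\<epsilon>>0. {(t, x). norm (x - x0) < \<epsilon> \<and> t0 - \<epsilon>\<^sup>2 < t \<and> t < t0} \<inter> U \<noteq> {})}"

text \<open>Semicontinuous envelopes relative to \<open>U\<close>; unlike \<open>at z within U\<close>, the filter used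
  here does not remove the point \<open>z\<close> itself. Meaningful for \<open>z\<close> in the closure of \<open>U\<close>.\<close>

definition usc_env :: "'a::topological_space set \<Rightarrow> ('a \<Rightarrow> real) \<Rightarrow> 'a \<Rightarrow> ereal" where
  "usc_env U u z = Limsup (inf (nhds z) (principal U)) (\<lambda>y. ereal (u y))"

definition lsc_env :: "'a::topological_space set \<Rightarrow> ('a \<Rightarrow> real) \<Rightarrow> 'a \<Rightarrow> ereal" where
  "lsc_env U u z = Liminf (inf (nhds z) (principal U)) (\<lambda>y. ereal (u y))"

definition Lp_loc :: "real \<Rightarrow> 'a::euclidean_space set \<Rightarrow> ('a \<Rightarrow> real) \<Rightarrow> bool" where
  "Lp_loc p Q f \<longleftrightarrow> f \<in> borel_measurable (lebesgue_on Q) \<and>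
     (\<forall>C. compact C \<and> C \<subseteq> Q \<longrightarrow> integrable (lebesgue_on C) (\<lambda>z. \<bar>f z\<bar> powr p))"

primrec Ck :: "nat \<Rightarrow> ('a::euclidean_space \<Rightarrow> real) \<Rightarrow> bool" where
  "Ck 0 f \<longleftrightarrow> continuous_on UNIV f"
| "Ck (Suc k) f \<longleftrightarrow> (\<forall>x. f differentiable (at x)) \<and>
     (\<forall>e. Ck k (\<lambda>x. frechet_derivative f (at x) e))"

definition test_function :: "'a::euclidean_space set \<Rightarrow> ('a \<Rightarrow> real) \<Rightarrow> bool" where
  "test_function Q \<phi> \<longleftrightarrow> (\<forall>k. Ck k \<phi>) \<and>
     compact (closure {z. \<phi> z \<noteq> 0}) \<and> closure {z. \<phi> z \<noteq> 0} \<subseteq> Q"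

text \<open>\<open>g\<close> is a version of the weak derivative of \<open>u\<close> on \<open>Q\<close> in direction \<open>e\<close>. Like classical
  derivatives in the library, weak derivatives are introduced as a relation; for open \<open>Q\<close> any two
  versions agree almost everywhere on \<open>Q\<close>.\<close>

definition weak_deriv ::
  "'a::euclidean_space set \<Rightarrow> 'a \<Rightarrow> ('a \<Rightarrow> real) \<Rightarrow> ('a \<Rightarrow> real) \<Rightarrow> bool" where
  "weak_deriv Q e u g \<longleftrightarrow> Lp_loc 1 Q u \<and> Lp_loc 1 Q g \<and>
     (\<forall>\<phi>. test_function Q \<phi> \<longrightarrow>
        (LINT z|lebesgue_on Q. u z * frechet_derivative \<phi> (at z) e) =
        - (LINT z|lebesgue_on Q. g z * \<phi> z))"

definition weak_jet :: "('d::finite) pt set \<Rightarrow> ('d pt \<Rightarrow> real) \<Rightarrow>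
    ('d pt \<Rightarrow> real) \<Rightarrow> ('d pt \<Rightarrow> real ^ 'd) \<Rightarrow>
    ('d pt \<Rightarrow> real ^ 'd ^ 'd) \<Rightarrow> bool" where
  "weak_jet Q u ut Du D2u \<longleftrightarrow>
     weak_deriv Q (1, 0) u ut \<and>
     (\<forall>i. weak_deriv Q (0, axis i 1) u (\<lambda>z. Du z $ i)) \<and>
     (\<forall>i j. weak_deriv Q (0, axis j 1) (\<lambda>z. Du z $ i) (\<lambda>z. D2u z $ i $ j))"

definition W2_loc :: "real \<Rightarrow> ('d::finite) pt set \<Rightarrow> ('d pt \<Rightarrow> real) set" where
  "W2_loc p Q = {u. Lp_loc p Q u \<and>
     (\<exists>ut Du D2u. weak_jet Q u ut Du D2u \<and> Lp_loc p Q ut \<and>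
        (\<forall>i. Lp_loc p Q (\<lambda>z. Du z $ i)) \<and> (\<forall>i j. Lp_loc p Q (\<lambda>z. D2u z $ i $ j)))}"

text \<open>The continuous representatives of the elements of \<open>W\<close> with exponent \<open>d + 1\<close>. Functions are
  total; their values outside \<open>Q\<close> are irrelevant.\<close>

definition W2_loc_cont :: "('d::finite) pt set \<Rightarrow> ('d pt \<Rightarrow> real) set" where
  "W2_loc_cont Q = {u \<in> W2_loc (real CARD('d) + 1) Q. continuous_on Q u}"

definition is_convex_cone :: "('a \<Rightarrow> real) set \<Rightarrow> bool" where
  "is_convex_cone K \<longleftrightarrow>
     (\<forall>u\<in>K. \<forall>v\<in>K. \<forall>\<alpha>\<ge>0. \<forall>\<beta>\<ge>0. (\<lambda>z. \<alpha> * u z + \<beta> * v z) \<in> K)"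

text \<open>\<open>g\<close> is a version of \<open>Lu = - u\<^sub>t - tr (a D\<^sup>2u) - \<langle>b, Du\<rangle> + c u\<close> on \<open>Q\<close>. Versions agree almost
  everywhere on \<open>Q\<close>, so quantifying existentially or universally over them amounts to the same.\<close>

definition L_version :: "('d::finite) pt set \<Rightarrow> ('d pt \<Rightarrow> real ^ 'd ^ 'd) \<Rightarrow>
    ('d pt \<Rightarrow> real ^ 'd) \<Rightarrow> ('d pt \<Rightarrow> real) \<Rightarrow>
    ('d pt \<Rightarrow> real) \<Rightarrow> ('d pt \<Rightarrow> real) \<Rightarrow> bool" where
  "L_version Q a b c u g \<longleftrightarrow> (\<exists>ut Du D2u. weak_jet Q u ut Du D2u \<and>
     g = (\<lambda>z. - ut z - trace (a z ** D2u z) - b z \<bullet> Du z + c z * u z))"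

text \<open>The closure of \<open>\<Sigma>\<close> in the boundary of \<open>Q\<close> is \<open>closure \<Sigma>\<close>, as that boundary is closed.\<close>

definition weak_max_principle :: "('d::finite) pt set \<Rightarrow>
    ('d pt \<Rightarrow> real ^ 'd ^ 'd) \<Rightarrow> ('d pt \<Rightarrow> real ^ 'd) \<Rightarrow>
    ('d pt \<Rightarrow> real) \<Rightarrow> ('d pt \<Rightarrow> real) set \<Rightarrow>
    'd pt set \<Rightarrow> 'd pt set \<Rightarrow> bool" where
  "weak_max_principle Q a b c K U \<Sigma> \<longleftrightarrow>
     (\<forall>w\<in>K. (\<exists>g. L_version Q a b c w g \<and> (AE z\<in>U in lebesgue. g z \<le> 0)) \<and>
        (\<forall>\<xi>\<in>parabolic_boundary U - closure \<Sigma>. usc_env U w \<xi> \<le> 0) \<longrightarrow>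
        (\<forall>z\<in>U. w z \<le> 0))"

definition obstacle_solution :: "('d::finite) pt set \<Rightarrow>
    ('d pt \<Rightarrow> real ^ 'd ^ 'd) \<Rightarrow> ('d pt \<Rightarrow> real ^ 'd) \<Rightarrow>
    ('d pt \<Rightarrow> real) \<Rightarrow> ('d pt \<Rightarrow> real) \<Rightarrow>
    ('d pt \<Rightarrow> real) \<Rightarrow> ('d pt \<Rightarrow> real) \<Rightarrow> bool" where
  "obstacle_solution Q a b c f \<psi> u \<longleftrightarrow> (\<exists>g. L_version Q a b c u g \<and>
     (AE z\<in>Q in lebesgue. min (g z - f z) (u z - \<psi> z) = 0))"

definition obstacle_supersolution :: "('d::finite) pt set \<Rightarrow>
    ('d pt \<Rightarrow> real ^ 'd ^ 'd) \<Rightarrow> ('d pt \<Rightarrow> real ^ 'd) \<Rightarrow>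
    ('d pt \<Rightarrow> real) \<Rightarrow> ('d pt \<Rightarrow> real) \<Rightarrow>
    ('d pt \<Rightarrow> real) \<Rightarrow> ('d pt \<Rightarrow> real) \<Rightarrow> bool" where
  "obstacle_supersolution Q a b c f \<psi> v \<longleftrightarrow> (\<exists>g. L_version Q a b c v g \<and>
     (AE z\<in>Q in lebesgue. min (g z - f z) (v z - \<psi> z) \<ge> 0))"

end

theory Submission
  imports Defs
begin

text \<open>
  The claim is a comparison principle on the set \<open>U = {z \<in> Q. v z < u z}\<close>. There
  \<open>u > v \<ge> \<psi>\<close>, so the obstacle is inactive for \<open>u\<close> and \<open>Lu = f \<le> Lv\<close> almost everywhere; by
  linearity of \<open>L\<close>, the function \<open>w = u - v\<close>, which lies in the cone as the sum of \<open>u\<close> and \<open>-v\<close>,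
  satisfies \<open>Lw \<le> 0\<close> almost everywhere on \<open>U\<close>. Once the upper envelope of \<open>w\<close> from \<open>U\<close> is known
  to be nonpositive on the parabolic boundary of \<open>U\<close> outside the closure of \<open>\<Sigma>\<close>, the weak maximum
  principle gives \<open>w \<le> 0\<close> on \<open>U\<close>, so that \<open>U\<close> is empty.

  The boundary points of \<open>U\<close> are of two kinds. At those inside \<open>Q\<close> the function \<open>w\<close> is continuous and
  nonpositive. A parabolic boundary point of \<open>U\<close> outside \<open>Q\<close> is a parabolic boundary point of \<open>Q\<close>
  (lemma \<open>parabolic_boundary_subset\<close>), where the hypothesis on the envelopes of \<open>u\<close> and \<open>v\<close>
  applies (lemma \<open>Limsup_diff_nonpos\<close>). The linearity of \<open>L\<close> rests on that of weak derivatives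
  (lemma \<open>weak_deriv_diff\<close>), for which the integrals against test functions must converge.
  Uniqueness follows by exchanging the two solutions.
\<close>

section \<open>Linearity of weak derivatives and of the operator\<close>

lemma Lp_loc_1_imp_integrable:
  assumes "Lp_loc 1 Q u" "compact C" "C \<subseteq> Q"
  shows "integrable (lebesgue_on C) u"
proof -
  have "u \<in> borel_measurable (lebesgue_on Q)"
    and "integrable (lebesgue_on C) (\<lambda>z. \<bar>u z\<bar> powr 1)"
    using assms unfolding Lp_loc_def by blast+
  then have "u \<in> borel_measurable (lebesgue_on C)" "integrable (lebesgue_on C) (\<lambda>z. \<bar>u z\<bar>)"
    using measurable_restrict_mono[OF _ \<open>C \<subseteq> Q\<close>] by (blast, simp)
  then show ?thesis
    by (simp only: integrable_abs_iff)
qed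

lemma Lp_loc_1_diff:
  assumes "Lp_loc 1 Q u" "Lp_loc 1 Q v"
  shows "Lp_loc 1 Q (\<lambda>z. u z - v z)"
  using assms Lp_loc_1_imp_integrable[OF assms(1)] Lp_loc_1_imp_integrable[OF assms(2)]
  unfolding Lp_loc_def by auto

text \<open>Local integrability of \<open>u\<close> only controls compact subsets of \<open>Q\<close>. The compact support \<open>C\<close> of
  \<open>h\<close> reduces the product to \<open>C\<close>, where \<open>h\<close> is bounded by compactness.\<close>

lemma integrable_Lp_loc_1_mult:
  fixes u h :: "'a::euclidean_space \<Rightarrow> real"
  assumes "open Q" "Lp_loc 1 Q u" "compact C" "C \<subseteq> Q"
    and h: "continuous_on UNIV h" "\<And>z. z \<notin> C \<Longrightarrow> h z = 0"
  shows "integrable (lebesgue_on Q) (\<lambda>z. u z * h z)"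
proof -
  have C: "C \<in> sets lebesgue" and Q: "Q \<in> sets lebesgue"
    using assms by (auto simp: borel_compact borel_open)
  have "u absolutely_integrable_on C"
    using Lp_loc_1_imp_integrable[OF assms(2-4)] C
    by (simp add: integrable_restrict_space set_integrable_def)
  moreover have "continuous_on C h"
    using h(1) continuous_on_subset by blast
  then have "h \<in> borel_measurable (lebesgue_on C)" "bounded (h ` C)"
    using C \<open>compact C\<close>
    by (auto intro: continuous_imp_measurable_on_sets_lebesgue compact_imp_bounded
        compact_continuous_image)
  ultimately have "(\<lambda>z. h z * u z) absolutely_integrable_on C"
    using C absolutely_integrable_bounded_measurable_product[OF bilinear_times, of h C u] by blast
  moreover have "(\<lambda>z. indicator C z *\<^sub>R (h z * u z)) = (\<lambda>z. indicator Q z *\<^sub>R (u z * h z))"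
    using h(2) \<open>C \<subseteq> Q\<close> by (auto simp: indicator_def fun_eq_iff)
  ultimately show ?thesis
    using Q by (simp add: integrable_restrict_space set_integrable_def)
qed

lemma test_function_derivative_eq_0:
  assumes "z \<notin> closure {z. \<phi> z \<noteq> 0}"
  shows "frechet_derivative \<phi> (at z) e = 0"
proof -
  have "(\<phi> has_derivative (\<lambda>_. 0)) (at z)"
    by (rule has_derivative_transform_within_open[where f = "\<lambda>_. 0"
          and s = "- closure {z. \<phi> z \<noteq> 0}"])
      (use assms closure_subset[of "{z. \<phi> z \<noteq> 0}"] in auto)
  then show ?thesis
    by (simp add: frechet_derivative_at[symmetric])
qed

text \<open>The two sides of the defining identity are subtracted from each other. The Lebesgue integral
  is additive only for integrable functions, so every product with a test function or with its
  derivative must first be shown to be integrable on \<open>Q\<close>.\<close>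

lemma weak_deriv_diff:
  assumes "open Q" "weak_deriv Q e u g" "weak_deriv Q e v h"
  shows "weak_deriv Q e (\<lambda>z. u z - v z) (\<lambda>z. g z - h z)"
proof -
  have loc: "Lp_loc 1 Q u" "Lp_loc 1 Q g" "Lp_loc 1 Q v" "Lp_loc 1 Q h"
    using assms unfolding weak_deriv_def by auto
  have "(LINT z|lebesgue_on Q. (u z - v z) * frechet_derivative \<phi> (at z) e) =
        - (LINT z|lebesgue_on Q. (g z - h z) * \<phi> z)" if \<phi>: "test_function Q \<phi>" for \<phi>
  proof -
    let ?C = "closure {z. \<phi> z \<noteq> 0}" and ?D = "\<lambda>z. frechet_derivative \<phi> (at z) e"
    have C: "compact ?C" "?C \<subseteq> Q"
      using \<phi> unfolding test_function_def by auto
    have "Ck 0 \<phi>" "Ck (Suc 0) \<phi>"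
      using \<phi> unfolding test_function_def by blast+
    then have cont: "continuous_on UNIV \<phi>" "continuous_on UNIV ?D"
      by auto
    have int_D: "integrable (lebesgue_on Q) (\<lambda>z. k z * ?D z)" if "Lp_loc 1 Q k" for k
      by (rule integrable_Lp_loc_1_mult[OF \<open>open Q\<close> that C cont(2)])
        (rule test_function_derivative_eq_0)
    have int_\<phi>: "integrable (lebesgue_on Q) (\<lambda>z. k z * \<phi> z)" if "Lp_loc 1 Q k" for k
      by (rule integrable_Lp_loc_1_mult[OF \<open>open Q\<close> that C cont(1)])
        (use closure_subset[of "{z. \<phi> z \<noteq> 0}"] in blast)
    have "(LINT z|lebesgue_on Q. (u z - v z) * ?D z) =
          (LINT z|lebesgue_on Q. u z * ?D z) - (LINT z|lebesgue_on Q. v z * ?D z)"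
      using int_D loc by (simp add: left_diff_distrib)
    also have "\<dots> = - (LINT z|lebesgue_on Q. g z * \<phi> z) + (LINT z|lebesgue_on Q. h z * \<phi> z)"
      using assms(2,3) \<phi> unfolding weak_deriv_def by simp
    also have "\<dots> = - (LINT z|lebesgue_on Q. (g z - h z) * \<phi> z)"
      using int_\<phi> loc by (simp add: left_diff_distrib)
    finally show ?thesis .
  qed
  then show ?thesis
    using loc Lp_loc_1_diff unfolding weak_deriv_def by blast
qed

lemma L_version_diff:
  fixes Q :: "('d::finite) pt set"
  assumes "open Q" "L_version Q a b c u g" "L_version Q a b c v h"
  shows "L_version Q a b c (\<lambda>z. u z - v z) (\<lambda>z. g z - h z)"
proof -
  obtain ut Du D2u where u: "weak_jet Q u ut Du D2u"
    and g: "g = (\<lambda>z. - ut z - trace (a z ** D2u z) - b z \<bullet> Du z + c z * u z)"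
    using assms(2) unfolding L_version_def by blast
  obtain vt Dv D2v where v: "weak_jet Q v vt Dv D2v"
    and h: "h = (\<lambda>z. - vt z - trace (a z ** D2v z) - b z \<bullet> Dv z + c z * v z)"
    using assms(3) unfolding L_version_def by blast
  have "weak_jet Q (\<lambda>z. u z - v z) (\<lambda>z. ut z - vt z) (\<lambda>z. Du z - Dv z) (\<lambda>z. D2u z - D2v z)"
    using u v \<open>open Q\<close> unfolding weak_jet_def by (simp add: weak_deriv_diff)
  moreover have trace_diff: "trace (A ** (B - C)) = trace (A ** B) - trace (A ** C)"
    for A B C :: "real^'d^'d"
    by (simp add: trace_def matrix_matrix_mult_def right_diff_distrib sum_subtractf)
  moreover have "(\<lambda>z. g z - h z) = (\<lambda>z. - (ut z - vt z) - trace (a z ** (D2u z - D2v z))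
      - b z \<bullet> (Du z - Dv z) + c z * (u z - v z))"
    by (simp add: fun_eq_iff g h trace_diff inner_diff_right right_diff_distrib)
  ultimately show ?thesis
    unfolding L_version_def by blast
qed

section \<open>Envelopes and parabolic boundaries\<close>

lemma Limsup_nonposI:
  assumes "\<And>e::real. e > 0 \<Longrightarrow> eventually (\<lambda>x. w x < e) F"
  shows "Limsup F (\<lambda>x. ereal (w x)) \<le> 0"
proof (rule ereal_le_epsilon2)
  fix e :: real assume "e > 0"
  then have "eventually (\<lambda>x. ereal (w x) \<le> ereal e) F"
    using eventually_mono[OF assms] by auto
  then show "Limsup F (\<lambda>x. ereal (w x)) \<le> 0 + ereal e"
    by (simp add: Limsup_bounded)
qed

text \<open>If the upper limit of \<open>u\<close> is strictly below the lower limit of \<open>v\<close>, a real number between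
  them separates \<open>u\<close> from \<open>v\<close> eventually, even when the limits are infinite. If they agree, the
  common value must be finite: \<open>u\<close> and \<open>v\<close> could both tend to infinity while \<open>u - v\<close> is a
  positive constant.\<close>

lemma Limsup_diff_nonpos:
  fixes u v :: "'a \<Rightarrow> real"
  assumes "Limsup F (\<lambda>x. ereal (u x)) \<le> Liminf F (\<lambda>x. ereal (v x))"
    and "Limsup F (\<lambda>x. ereal (u x)) = Liminf F (\<lambda>x. ereal (v x)) \<Longrightarrow>
      \<bar>Limsup F (\<lambda>x. ereal (u x))\<bar> \<noteq> \<infinity>"
  shows "Limsup F (\<lambda>x. ereal (u x - v x)) \<le> 0"
proof (rule Limsup_nonposI)
  fix e :: real assume "e > 0"
  have "\<exists>r s. Limsup F (\<lambda>x. ereal (u x)) < ereal r \<and> ereal s < Liminf F (\<lambda>x. ereal (v x)) \<and>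
    r - s \<le> e"
  proof (cases "Limsup F (\<lambda>x. ereal (u x)) = Liminf F (\<lambda>x. ereal (v x))")
    case True
    then obtain l where "Limsup F (\<lambda>x. ereal (u x)) = ereal l" "Liminf F (\<lambda>x. ereal (v x)) = ereal l"
      using assms(2) by auto
    then show ?thesis
      using \<open>e > 0\<close> by (intro exI[of _ "l + e / 2"] exI[of _ "l - e / 2"]) auto
  next
    case False
    then have "Limsup F (\<lambda>x. ereal (u x)) < Liminf F (\<lambda>x. ereal (v x))"
      using assms(1) by auto
    then obtain r where "Limsup F (\<lambda>x. ereal (u x)) < ereal r" "ereal r < Liminf F (\<lambda>x. ereal (v x))"
      using ereal_dense2 by blast
    then show ?thesis
      using \<open>e > 0\<close> by (intro exI[of _ r]) auto
  qed
  then obtain r s where "Limsup F (\<lambda>x. ereal (u x)) < ereal r"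
    "ereal s < Liminf F (\<lambda>x. ereal (v x))" "r - s \<le> e"
    by blast
  then have "eventually (\<lambda>x. ereal (u x) < ereal r) F" "eventually (\<lambda>x. ereal s < ereal (v x)) F"
    by (auto dest: Limsup_lessD less_LiminfD)
  then show "eventually (\<lambda>x. u x - v x < e) F"
    by eventually_elim (use \<open>r - s \<le> e\<close> in auto)
qed

lemma usc_env_diff_nonpos:
  assumes "U \<subseteq> Q" "usc_env Q u \<xi> \<le> lsc_env Q v \<xi>"
    and "usc_env Q u \<xi> = lsc_env Q v \<xi> \<Longrightarrow> \<bar>usc_env Q u \<xi>\<bar> \<noteq> \<infinity>"
  shows "usc_env U (\<lambda>z. u z - v z) \<xi> \<le> 0"
proof -
  have "usc_env U (\<lambda>z. u z - v z) \<xi> \<le> usc_env Q (\<lambda>z. u z - v z) \<xi>"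
    unfolding usc_env_def Limsup_def using \<open>U \<subseteq> Q\<close>
    by (intro INF_superset_mono) (auto simp: eventually_inf_principal elim: eventually_mono)
  also have "\<dots> \<le> 0"
    using assms(2,3) unfolding usc_env_def lsc_env_def by (rule Limsup_diff_nonpos)
  finally show ?thesis .
qed

lemma usc_env_nonpos_interior:
  fixes w :: "'a::t2_space \<Rightarrow> real"
  assumes "open Q" "U \<subseteq> Q" "\<xi> \<in> Q" "continuous_on Q w" "w \<xi> \<le> 0"
  shows "usc_env U w \<xi> \<le> 0"
  unfolding usc_env_def
proof (rule Limsup_nonposI)
  fix e :: real assume "e > 0"
  have "isCont w \<xi>"
    using assms continuous_on_eq_continuous_at by blast
  then have "filterlim w (nhds (w \<xi>)) (nhds \<xi>)"
    by (simp add: continuous_at tendsto_at_iff_tendsto_nhds)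
  then have "eventually (\<lambda>x. w x < e) (nhds \<xi>)"
    by (rule order_tendstoD) (use \<open>e > 0\<close> \<open>w \<xi> \<le> 0\<close> in simp)
  then show "eventually (\<lambda>x. w x < e) (inf (nhds \<xi>) (principal U))"
    by (rule filter_leD[rotated]) simp
qed

text \<open>The backward parabolic neighbourhoods of \<open>\<xi>\<close> that meet \<open>U\<close> also meet \<open>Q\<close>, and \<open>\<xi>\<close> is a limit
  of points of \<open>U\<close>; leaving the open set \<open>Q\<close> makes it a boundary point of \<open>Q\<close>.\<close>

lemma parabolic_boundary_subset:
  assumes "U \<subseteq> Q" "open Q" "\<xi> \<in> parabolic_boundary U" "\<xi> \<notin> Q"
  shows "\<xi> \<in> parabolic_boundary Q"
proof -
  have "\<xi> \<in> closure Q"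
    using assms closure_mono[of U Q] unfolding parabolic_boundary_def frontier_def by auto
  then have "\<xi> \<in> frontier Q"
    using assms unfolding frontier_def by (simp add: interior_open)
  then show ?thesis
    using assms(1,3) unfolding parabolic_boundary_def by fast
qed

lemma lsc_env_le_usc_env:
  assumes "\<xi> \<in> closure Q"
  shows "lsc_env Q u \<xi> \<le> usc_env Q u \<xi>"
proof -
  have "inf (nhds \<xi>) (principal Q) \<noteq> bot"
    unfolding trivial_limit_def eventually_inf_principal eventually_nhds
    using assms open_Int_closure_eq_empty[of _ Q] by blast
  then show ?thesis
    unfolding lsc_env_def usc_env_def by (rule Liminf_le_Limsup)
qed

section \<open>Comparison for the obstacle problem\<close>

text \<open>This one-sided comparison serves both parts: the first directly, the second once for each
  order of the two solutions.\<close>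

lemma obstacle_comparison:
  fixes Q \<Sigma> :: "('d::finite) pt set"
  assumes "open Q" and K: "K \<subseteq> W2_loc_cont Q" "is_convex_cone K"
    and wmp: "\<forall>U. open U \<longrightarrow> U \<subseteq> Q \<longrightarrow> weak_max_principle Q a b c K U \<Sigma>"
    and u: "u \<in> K" "obstacle_solution Q a b c f \<psi> u"
    and v: "(\<lambda>z. - v z) \<in> K" "obstacle_supersolution Q a b c f \<psi> v"
    and bd: "\<And>\<xi>. \<xi> \<in> parabolic_boundary Q - closure \<Sigma> \<Longrightarrow>
      usc_env Q u \<xi> \<le> lsc_env Q v \<xi> \<and>
      (usc_env Q u \<xi> = lsc_env Q v \<xi> \<longrightarrow> \<bar>usc_env Q u \<xi>\<bar> \<noteq> \<infinity>)"
    and "z \<in> Q"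
  shows "u z \<le> v z"
proof (rule ccontr)
  assume "\<not> u z \<le> v z"
  define w where "w = (\<lambda>z. u z - v z)"
  define U where "U = {z \<in> Q. 0 < w z}"
  have "w \<in> K"
    using K(2)[unfolded is_convex_cone_def, rule_format, OF u(1) v(1), of 1 1]
    by (simp add: w_def)
  then have cont: "continuous_on Q w"
    using K(1) unfolding W2_loc_cont_def by blast
  have "U \<subseteq> Q"
    unfolding U_def by blast
  have "open U"
    unfolding U_def using continuous_open_preimage[OF cont \<open>open Q\<close>, of "{0<..}"]
    by (simp add: vimage_def Int_def)
  obtain g where g: "L_version Q a b c u g"
    "AE z\<in>Q in lebesgue. min (g z - f z) (u z - \<psi> z) = 0"
    using u(2) unfolding obstacle_solution_def by blast
  obtain h where h: "L_version Q a b c v h"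
    "AE z\<in>Q in lebesgue. min (h z - f z) (v z - \<psi> z) \<ge> 0"
    using v(2) unfolding obstacle_supersolution_def by blast
  have "L_version Q a b c w (\<lambda>z. g z - h z)"
    using L_version_diff[OF \<open>open Q\<close> g(1) h(1)] by (simp add: w_def)
  \<comment> \<open>On \<open>U\<close> the second entry of the minimum for \<open>u\<close> is positive, as \<open>u > v \<ge> \<psi>\<close>, so \<open>g = f \<le> h\<close>.\<close>
  moreover have "AE z\<in>U in lebesgue. g z - h z \<le> 0"
    using g(2) h(2) by eventually_elim (auto simp: U_def w_def min_def split: if_splits)
  moreover have "usc_env U w \<xi> \<le> 0" if \<xi>: "\<xi> \<in> parabolic_boundary U - closure \<Sigma>" for \<xi>
  proof (cases "\<xi> \<in> Q")
    case True
    have "\<xi> \<notin> U"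
      using \<xi> \<open>open U\<close> unfolding parabolic_boundary_def frontier_def by (auto simp: interior_open)
    then have "w \<xi> \<le> 0"
      using True unfolding U_def by auto
    then show ?thesis
      using usc_env_nonpos_interior \<open>open Q\<close> \<open>U \<subseteq> Q\<close> True cont by blast
  next
    case False
    then have "\<xi> \<in> parabolic_boundary Q - closure \<Sigma>"
      using parabolic_boundary_subset \<open>open Q\<close> \<open>U \<subseteq> Q\<close> \<xi> by blast
    note bd = bd[OF this]
    show ?thesis
      unfolding w_def
      by (rule usc_env_diff_nonpos[OF \<open>U \<subseteq> Q\<close> conjunct1[OF bd] mp[OF conjunct2[OF bd]]])
  qed
  ultimately have "\<forall>z\<in>U. w z \<le> 0"
    using wmp[rule_format, OF \<open>open U\<close> \<open>U \<subseteq> Q\<close>] \<open>w \<in> K\<close> unfolding weak_max_principle_def by blast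
  moreover have "z \<in> U"
    using \<open>z \<in> Q\<close> \<open>\<not> u z \<le> v z\<close> by (simp add: U_def w_def)
  ultimately have "w z \<le> 0"
    by blast
  with \<open>z \<in> U\<close> show False
    by (simp add: U_def)
qed

lemma obstacle_solution_imp_supersolution:
  "obstacle_solution Q a b c f \<psi> u \<Longrightarrow> obstacle_supersolution Q a b c f \<psi> u"
  unfolding obstacle_solution_def obstacle_supersolution_def by (force elim: eventually_mono)

theorem proposition3p2:
  fixes Q \<Sigma> :: "('d::finite) pt set"
    and K :: "('d pt \<Rightarrow> real) set"
    and a :: "'d pt \<Rightarrow> real ^ 'd ^ 'd"
    and b :: "'d pt \<Rightarrow> real ^ 'd"
    and c f \<psi> u v :: "'d pt \<Rightarrow> real"
  assumes "open Q"
    and "a \<in> borel_measurable (lebesgue_on Q)"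
    and "AE z\<in>Q in lebesgue. transpose (a z) = a z \<and> (\<forall>y. y \<bullet> (a z *v y) \<ge> 0)"
    and "b \<in> borel_measurable (lebesgue_on Q)"
    and "c \<in> borel_measurable (lebesgue_on Q)"
    and "K \<subseteq> W2_loc_cont Q"
    and "is_convex_cone K"
    and "openin (top_of_set (parabolic_boundary Q)) \<Sigma>"
    and "\<And>U. open U \<Longrightarrow> U \<subseteq> Q \<Longrightarrow> weak_max_principle Q a b c K U \<Sigma>"
    and "Lp_loc (real CARD('d) + 1) Q f"
    and "Lp_loc (real CARD('d) + 1) Q \<psi>"
    and "u \<in> K"
    and "obstacle_solution Q a b c f \<psi> u"
    and "(\<lambda>z. - v z) \<in> K"
    and "obstacle_supersolution Q a b c f \<psi> v"
  shows "((\<forall>\<xi>\<in>parabolic_boundary Q - closure \<Sigma>.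
            usc_env Q u \<xi> \<le> lsc_env Q v \<xi> \<and>
            (usc_env Q u \<xi> = lsc_env Q v \<xi> \<longrightarrow> \<bar>usc_env Q u \<xi>\<bar> \<noteq> \<infinity>))
         \<longrightarrow> (\<forall>z\<in>Q. u z \<le> v z)) \<and>
         (obstacle_solution Q a b c f \<psi> v \<and> v \<in> K \<and> (\<lambda>z. - u z) \<in> K \<and>
         (\<forall>\<xi>\<in>parabolic_boundary Q - closure \<Sigma>.
            lsc_env Q v \<xi> = usc_env Q u \<xi> \<and> lsc_env Q u \<xi> = usc_env Q v \<xi> \<and>
            \<bar>usc_env Q u \<xi>\<bar> \<noteq> \<infinity>)
         \<longrightarrow> (\<forall>z\<in>Q. u z = v z))"
proof -
  have wmp: "\<forall>U. open U \<longrightarrow> U \<subseteq> Q \<longrightarrow> weak_max_principle Q a b c K U \<Sigma>"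
    using assms(9) by blast
  show ?thesis
  proof (intro conjI impI ballI)
    fix z
    assume bd: "\<forall>\<xi>\<in>parabolic_boundary Q - closure \<Sigma>.
        usc_env Q u \<xi> \<le> lsc_env Q v \<xi> \<and>
        (usc_env Q u \<xi> = lsc_env Q v \<xi> \<longrightarrow> \<bar>usc_env Q u \<xi>\<bar> \<noteq> \<infinity>)" and "z \<in> Q"
    show "u z \<le> v z"
      by (rule obstacle_comparison[OF assms(1,6,7) wmp assms(12-15) _ \<open>z \<in> Q\<close>])
        (rule bspec[OF bd])
  next
    fix z
    assume sol: "obstacle_solution Q a b c f \<psi> v \<and> v \<in> K \<and> (\<lambda>z. - u z) \<in> K \<and>
        (\<forall>\<xi>\<in>parabolic_boundary Q - closure \<Sigma>.
           lsc_env Q v \<xi> = usc_env Q u \<xi> \<and> lsc_env Q u \<xi> = usc_env Q v \<xi> \<and>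
           \<bar>usc_env Q u \<xi>\<bar> \<noteq> \<infinity>)" and "z \<in> Q"
    then have v: "v \<in> K" "obstacle_solution Q a b c f \<psi> v" and mu: "(\<lambda>z. - u z) \<in> K"
      by blast+
    have bd: "lsc_env Q v \<xi> = usc_env Q u \<xi>" "lsc_env Q u \<xi> = usc_env Q v \<xi>"
      "\<bar>usc_env Q u \<xi>\<bar> \<noteq> \<infinity>" if "\<xi> \<in> parabolic_boundary Q - closure \<Sigma>" for \<xi>
      using bspec[OF sol[THEN conjunct2, THEN conjunct2, THEN conjunct2] that] by simp_all
    have "u z \<le> v z"
      by (rule obstacle_comparison[OF assms(1,6,7) wmp assms(12-15) _ \<open>z \<in> Q\<close>])
        (simp only: bd order_refl simp_thms not_False_eq_True)
    moreover have "v z \<le> u z"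
    proof (rule obstacle_comparison[OF assms(1,6,7) wmp v mu
          obstacle_solution_imp_supersolution[OF assms(13)] _ \<open>z \<in> Q\<close>])
      fix \<xi> assume \<xi>: "\<xi> \<in> parabolic_boundary Q - closure \<Sigma>"
      then have "\<xi> \<in> closure Q"
        unfolding parabolic_boundary_def frontier_def by auto
      \<comment> \<open>Along \<open>u\<^sup>* = v\<^sub>* \<le> v\<^sup>* = u\<^sub>* \<le> u\<^sup>*\<close> equality holds throughout, so \<open>v\<^sup>*\<close> is finite as well.\<close>
      then have "usc_env Q v \<xi> = usc_env Q u \<xi>"
        using lsc_env_le_usc_env[of \<xi> Q u] lsc_env_le_usc_env[of \<xi> Q v] bd(1,2)[OF \<xi>]
        by (intro antisym) simp_all
      then show "usc_env Q v \<xi> \<le> lsc_env Q u \<xi> \<and>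
          (usc_env Q v \<xi> = lsc_env Q u \<xi> \<longrightarrow> \<bar>usc_env Q v \<xi>\<bar> \<noteq> \<infinity>)"
        using bd(2,3)[OF \<xi>] by (metis order_refl)
    qed
    ultimately show "u z = v z"
      by (rule antisym)
  qed
qed

end
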